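(* Let $(V,\diamond)$ be a left skew-symmetric algebra over $\mathbb{R}$. Then the binary operation $$X\bullet Y:=X\diamond Y+Y\diamond X,\quad X,Y\in V,$$ makes $V$ a Jordan algebra, i.e. $X\bullet Y=Y\bullet X$ and $X\bullet((X\bullet X)\bullet Y)=(X\bullet X)\bullet(X\bullet Y)$ for all $X,Y\in V$.
   Context: A left skew-symmetric algebra (LSSA) is a real vector space $V$ with a bilinear product $\diamond$ satisfying $$(X\diamond Y)\diamond Z-X\diamond(Y\diamond Z)=-(Y\diamond X)\diamond Z+Y\diamond(X\diamond Z)\quad\text{for all }X,Y,Z\in V.$$ *)

theory Defs
  imports "HOL-Analysis.Analysis"
begin

definition left_skew_symmetric_algebra :: "('a::real_vector \<Rightarrow> 'a \<Rightarrow> 'a) \<Rightarrow> bool" where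
  "left_skew_symmetric_algebra m \<longleftrightarrow> bilinear m \<and>
     (\<forall>X Y Z. m (m X Y) Z - m X (m Y Z) = - m (m Y X) Z + m Y (m X Z))"

definition jordan_algebra :: "('a::real_vector \<Rightarrow> 'a \<Rightarrow> 'a) \<Rightarrow> bool" where
  "jordan_algebra m \<longleftrightarrow> bilinear m \<and>
     (\<forall>X Y. m X Y = m Y X) \<and>
     (\<forall>X Y. m X (m (m X X) Y) = m (m X X) (m X Y))"

end

theory Submission
  imports Defs
begin

text \<open>Write \<open>L\<^sub>X\<close> for left multiplication by \<open>X\<close>. The left skew-symmetry of the associator says exactly
  that \<open>X \<mapsto> L\<^sub>X\<close> turns \<open>X \<bullet> Y = X \<diamond> Y + Y \<diamond> X\<close> into the anticommutator \<open>L\<^sub>X L\<^sub>Y + L\<^sub>Y L\<^sub>X\<close>; in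
  particular \<open>L\<close> of the square \<open>X \<diamond> X\<close> is the square of \<open>L\<^sub>X\<close>, since 2 is invertible. After
  adjoining a unit, where \<open>L\<^sub>X 1 = X\<close>, this map is injective, so \<open>\<bullet>\<close> is a special Jordan product
  because the anticommutator of linear maps is one. The proof below carries out that argument without
  the unit: every product whose left factor is of the form \<open>U \<bullet> V\<close> is resolved into nested left
  multiplications, after which only the commutation of \<open>L\<^sub>X\<close> with its square remains to be used.\<close>

lemma lssa_anticommutator:
  assumes "left_skew_symmetric_algebra m"
  shows "m (m X Y + m Y X) Z = m X (m Y Z) + m Y (m X Z)"
proof -
  have "bilinear m" and "m (m X Y) Z - m X (m Y Z) = - m (m Y X) Z + m Y (m X Z)"
    using assms unfolding left_skew_symmetric_algebra_def by blast+
  then show ?thesis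
    by (simp add: bilinear_ladd algebra_simps)
qed

text \<open>The case \<open>X = Y\<close> of the anticommutator rule, halved.\<close>

lemma lssa_left_alternative:
  fixes m :: "'a::real_vector \<Rightarrow> 'a \<Rightarrow> 'a"
  assumes "left_skew_symmetric_algebra m"
  shows "m (m X X) Z = m X (m X Z)"
proof -
  have "bilinear m"
    using assms unfolding left_skew_symmetric_algebra_def by blast
  then have "2 *\<^sub>R m (m X X) Z = 2 *\<^sub>R m X (m X Z)"
    using lssa_anticommutator[OF assms, of X X Z] by (simp add: bilinear_ladd scaleR_2)
  then show ?thesis
    by simp
qed

lemma bilinear_symmetrization:
  assumes "bilinear m"
  shows "bilinear (\<lambda>X Y. m X Y + m Y X)"
  using assms unfolding bilinear_def by (auto intro: linear_compose_add)

lemma lssa_jordan_identity: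
  fixes m :: "'a::real_vector \<Rightarrow> 'a \<Rightarrow> 'a"
  assumes lssa: "left_skew_symmetric_algebra m"
  defines "j \<equiv> \<lambda>X Y. m X Y + m Y X"
  shows "j X (j (m X X) Y) = j (m X X) (j X Y)"
proof -
  have bil: "bilinear m"
    using lssa unfolding left_skew_symmetric_algebra_def by blast
  define W where "W = m X X"
  have sq: "m W Z = m X (m X Z)" for Z
    unfolding W_def by (rule lssa_left_alternative[OF lssa])
  have comm: "m X (m W Z) = m W (m X Z)" for Z
    by (simp add: sq)
  \<comment> \<open>The counterpart of \<open>comm\<close> applied to an adjoined unit.\<close>
  have cube: "m W X = m X W"
    using sq[of X] by (simp add: W_def)
  have "j X (j W Y) = m X (m W Y) + m X (m Y W) + (m W (m Y X) + m Y (m W X))"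
    by (simp add: j_def lssa_anticommutator[OF lssa] bilinear_radd[OF bil])
  also have "\<dots> = m W (m X Y) + m W (m Y X) + (m X (m Y W) + m Y (m X W))"
    by (simp add: comm cube algebra_simps)
  also have "\<dots> = j W (j X Y)"
    by (simp add: j_def lssa_anticommutator[OF lssa] bilinear_radd[OF bil])
  finally show ?thesis
    unfolding W_def .
qed

theorem theorem3p9:
  fixes m :: "'a::real_vector \<Rightarrow> 'a \<Rightarrow> 'a"
  assumes "left_skew_symmetric_algebra m"
  shows "jordan_algebra (\<lambda>X Y. m X Y + m Y X)"
proof -
  define j where "j = (\<lambda>X Y. m X Y + m Y X)"
  have "bilinear m"
    using assms unfolding left_skew_symmetric_algebra_def by blast
  then have bil: "bilinear j"
    unfolding j_def by (rule bilinear_symmetrization)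
  have "j X (j (j X X) Y) = j (j X X) (j X Y)" for X Y
  proof -
    \<comment> \<open>The Jordan square is twice the original square, and the identity is linear in it.\<close>
    have "j X X = m X X + m X X"
      by (simp add: j_def)
    moreover have "j X (j (m X X) Y) = j (m X X) (j X Y)"
      unfolding j_def by (rule lssa_jordan_identity[OF assms])
    ultimately show ?thesis
      by (simp add: bilinear_ladd[OF bil] bilinear_radd[OF bil])
  qed
  moreover have "j X Y = j Y X" for X Y
    by (simp add: j_def add.commute)
  ultimately have "jordan_algebra j"
    using bil unfolding jordan_algebra_def by blast
  then show ?thesis
    unfolding j_def .
qed

end
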